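(* Let $C$ be a conjugation on a Hilbert space $\mathcal H$ and let $A$ be a densely defined, closed and non-maximal symmetric operator on $\mathcal H$ which is, in addition, $C$-symmetric. Then $A$ admits extensions that are self-adjoint and $C$-self-adjoint. If the condition $\mathfrak N_{\bar\lambda}\cap C\mathfrak N_\lambda=\{0\}$ is fulfilled for some nonreal $\lambda$, then it is true for each nonreal $\lambda$, and the adjoint pair $\{A,CAC\}$ admits a unique maximal dissipative extension. This unique extension is a self-adjoint and $C$-self-adjoint operator.
   Context: A conjugation on $\mathcal H$ is an anti-linear isometric operator $C$ on $\mathcal H$ with $C^2=I$. A densely defined operator $A$ is $C$-symmetric if $A\subseteq CA^*C$ and $C$-self-adjoint if $A=CA^*C$. A symmetric operator is maximal symmetric if it has no proper symmetric extension on $\mathcal H$. For nonreal $\lambda$, $\mathfrak N_\lambda:=\mathcal H\ominus\operatorname{ran}(A-\bar\lambda I)=\ker(A^*-\lambda I)$. An operator $T$ is dissipative if $\operatorname{Im}(Tf,f)\ge0$ for all $f\in\operatorname{dom}T$, and maximal dissipative if it is dissipative and has no proper dissipative extension on $\mathcal H$. The operator $CAC$ has domain $C\operatorname{dom}A$ and $\{A,CAC\}$ is an adjoint pair, i.e. $(Af,g)=(f,CACg)$ for $f\in\operatorname{dom}A$, $g\in C\operatorname{dom}A$. A maximal dissipative extension of the adjoint pair $\{A,CAC\}$ is a maximal dissipative operator $\widetilde A$ on $\mathcal H$ with $\widetilde A\supseteq A$ and $\widetilde A^*\supseteq CAC$. *)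

theory Defs
  imports "HOL-Analysis.Analysis"
begin

text \<open>
  Complex Hilbert spaces. The inner product is linear in the first argument, so that
  ``dissipative'' below means that the numerical range lies in the closed upper half-plane.
  The last axiom includes positive definiteness, through that of the norm.
\<close>

class complex_inner = real_normed_vector +
  fixes scaleC :: "complex \<Rightarrow> 'a \<Rightarrow> 'a"  (infixr "*\<^sub>C" 75)
    and cinner :: "'a \<Rightarrow> 'a \<Rightarrow> complex"
  assumes scaleC_add_right: "a *\<^sub>C (x + y) = a *\<^sub>C x + a *\<^sub>C y"
    and scaleC_add_left: "(a + b) *\<^sub>C x = a *\<^sub>C x + b *\<^sub>C x"
    and scaleC_scaleC: "a *\<^sub>C (b *\<^sub>C x) = (a * b) *\<^sub>C x"
    and scaleC_one: "1 *\<^sub>C x = x"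
    and scaleR_scaleC: "scaleR r x = complex_of_real r *\<^sub>C x"
    and cinner_commute: "cinner x y = cnj (cinner y x)"
    and cinner_add_left: "cinner (x + y) z = cinner x z + cinner y z"
    and cinner_scaleC_left: "cinner (a *\<^sub>C x) y = a * cinner x y"
    and cinner_self: "cinner x x = complex_of_real ((norm x)\<^sup>2)"

class chilbert_space = complex_inner + complete_space

text \<open>
  Unbounded operators are identified with their graphs; thus \<open>(f, f') \<in> T\<close> means that
  \<open>f\<close> lies in the domain and \<open>T f = f'\<close>, an extension is a superset, and the domain and range
  are \<^const>\<open>Domain\<close> and \<^const>\<open>Range\<close>.
  A closed operator is one whose graph is \<^const>\<open>closed\<close> in the product space.
\<close>

type_synonym 'a graph = "('a \<times> 'a) set"

definition linear_op :: "'a::complex_inner graph \<Rightarrow> bool" where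
  "linear_op T \<longleftrightarrow> single_valued T \<and> (0, 0) \<in> T \<and>
     (\<forall>(f, f') \<in> T. \<forall>(g, g') \<in> T. (f + g, f' + g') \<in> T) \<and>
     (\<forall>a. \<forall>(f, f') \<in> T. (a *\<^sub>C f, a *\<^sub>C f') \<in> T)"

definition densely_defined :: "'a::complex_inner graph \<Rightarrow> bool" where
  "densely_defined T \<longleftrightarrow> closure (Domain T) = UNIV"

text \<open>This relation is (the graph of) an operator precisely when \<open>T\<close> is densely defined.\<close>

definition op_adjoint :: "'a::complex_inner graph \<Rightarrow> 'a graph" where
  "op_adjoint T = {(g, g'). \<forall>(f, f') \<in> T. cinner f' g = cinner f g'}"

definition symmetric_op :: "'a::complex_inner graph \<Rightarrow> bool" where
  "symmetric_op T \<longleftrightarrow> linear_op T \<and> densely_defined T \<and>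
     (\<forall>(f, f') \<in> T. \<forall>(g, g') \<in> T. cinner f' g = cinner f g')"

definition maximal_symmetric :: "'a::complex_inner graph \<Rightarrow> bool" where
  "maximal_symmetric T \<longleftrightarrow> symmetric_op T \<and> \<not> (\<exists>S. symmetric_op S \<and> T \<subset> S)"

definition self_adjoint :: "'a::complex_inner graph \<Rightarrow> bool" where
  "self_adjoint T \<longleftrightarrow> linear_op T \<and> densely_defined T \<and> T = op_adjoint T"

definition conjugation :: "('a::complex_inner \<Rightarrow> 'a) \<Rightarrow> bool" where
  "conjugation C \<longleftrightarrow> (\<forall>x y. C (x + y) = C x + C y) \<and> (\<forall>a x. C (a *\<^sub>C x) = cnj a *\<^sub>C C x) \<and>
     (\<forall>x. norm (C x) = norm x) \<and> (\<forall>x. C (C x) = x)"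

text \<open>The product \<open>C T C\<close>; its domain is \<open>C (dom T)\<close> when \<open>C\<close> is an involution.\<close>

definition conj_by :: "('a \<Rightarrow> 'a) \<Rightarrow> 'a graph \<Rightarrow> 'a graph" where
  "conj_by C T = {(f, C h) | f h. (C f, h) \<in> T}"

definition C_symmetric :: "('a::complex_inner \<Rightarrow> 'a) \<Rightarrow> 'a graph \<Rightarrow> bool" where
  "C_symmetric C T \<longleftrightarrow> linear_op T \<and> densely_defined T \<and> T \<subseteq> conj_by C (op_adjoint T)"

definition C_self_adjoint :: "('a::complex_inner \<Rightarrow> 'a) \<Rightarrow> 'a graph \<Rightarrow> bool" where
  "C_self_adjoint C T \<longleftrightarrow> linear_op T \<and> densely_defined T \<and> T = conj_by C (op_adjoint T)"

definition op_shift :: "'a::complex_inner graph \<Rightarrow> complex \<Rightarrow> 'a graph" where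
  "op_shift T \<mu> = {(f, f' - \<mu> *\<^sub>C f) | f f'. (f, f') \<in> T}"

definition ortho_compl :: "'a::complex_inner set \<Rightarrow> 'a set" where
  "ortho_compl S = {g. \<forall>f\<in>S. cinner f g = 0}"

definition deficiency_space :: "'a::complex_inner graph \<Rightarrow> complex \<Rightarrow> 'a set" where
  "deficiency_space T \<mu> = ortho_compl (Range (op_shift T (cnj \<mu>)))"

definition dissipative :: "'a::complex_inner graph \<Rightarrow> bool" where
  "dissipative T \<longleftrightarrow> linear_op T \<and> (\<forall>(f, f') \<in> T. Im (cinner f' f) \<ge> 0)"

definition maximal_dissipative :: "'a::complex_inner graph \<Rightarrow> bool" where
  "maximal_dissipative T \<longleftrightarrow> dissipative T \<and> \<not> (\<exists>S. dissipative S \<and> T \<subset> S)"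

text \<open>Meant for an adjoint pair \<open>{A, B}\<close>; \<open>{A, C A C}\<close> is one whenever \<open>A\<close> is \<open>C\<close>-symmetric.\<close>

definition max_dissipative_ext :: "'a::complex_inner graph \<Rightarrow> 'a graph \<Rightarrow> 'a graph \<Rightarrow> bool" where
  "max_dissipative_ext A B T \<longleftrightarrow> maximal_dissipative T \<and> A \<subseteq> T \<and> B \<subseteq> op_adjoint T"

end

theory Submission
  imports Defs
begin

text \<open>
  Since \<open>A\<close> is symmetric and \<open>C\<close>-symmetric, \<open>A\<close> and \<open>C A C\<close> are both contained in the adjoint of
  either one. Hence their linear span \<open>S\<close>, formed in the graph space, is again a symmetric operator;
  its adjoint is \<open>S\<^sup>* = A\<^sup>* \<inter> (C A C)\<^sup>*\<close>, and it is real: \<open>C S C = S\<close>. All claims become claims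
  about the real symmetric operator \<open>S\<close>.

  \<^item> Existence. Zorn's lemma gives a maximal real symmetric extension \<open>B\<close> of \<open>S\<close>, and such a \<open>B\<close> is
    self-adjoint (\<open>self_adjoint_if_maximal_real_symmetric\<close>). For if \<open>(h, h')\<close> in the graph of
    \<open>B\<^sup>*\<close> is fixed by \<open>C\<close>, then \<open>C\<close> turns \<open>\<langle>h', h\<rangle>\<close> into its conjugate, so this number is real
    and \<open>(h, h')\<close> can be adjoined to \<open>B\<close>; by maximality it lies in \<open>B\<close> already. But the pairs fixed
    by \<open>C\<close> span the graph of \<open>B\<^sup>*\<close>, through real and imaginary parts. A real self-adjoint operator
    is \<open>C\<close>-self-adjoint.

  \<^item> The condition on the deficiency spaces at \<open>\<mu>\<close> says that \<open>cnj \<mu>\<close> is not an eigenvalue of \<open>S\<^sup>*\<close>.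
    As \<open>B - cnj \<mu>\<close> is onto for the self-adjoint operator \<open>B\<close>, no proper linear extension of \<open>B\<close>
    keeps \<open>cnj \<mu>\<close> out of the eigenvalues (\<open>self_adjoint_eq_if_subset\<close>), so \<open>S\<^sup>* = B\<close>. Then
    \<open>S\<^sup>*\<close> has no nonreal eigenvalue at all, which is the condition at every nonreal point.

  \<^item> Uniqueness. A dissipative extension of a symmetric operator is contained in the adjoint of
    that operator (\<open>dissipative_ext_subset_op_adjoint\<close>). A maximal dissipative extension of the
    pair is thus contained in \<open>A\<^sup>*\<close>; since its adjoint extends \<open>C A C\<close>, it is also contained
    in \<open>(C A C)\<^sup>*\<close>. So it is contained in \<open>S\<^sup>* = B\<close>, hence equal to \<open>B\<close>. The same containment,
    applied to \<open>B = B\<^sup>*\<close>, shows that \<open>B\<close> is maximal dissipative.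
\<close>

section \<open>Complex inner product spaces\<close>

lemma scaleC_zero_left [simp]: "0 *\<^sub>C x = (0::'a::complex_inner)"
  using scaleR_scaleC[of 0 x] by simp

lemma scaleC_zero_right [simp]: "a *\<^sub>C (0::'a::complex_inner) = 0"
  using scaleC_add_right[of a 0 0] by simp

declare scaleC_one [simp]

lemma scaleC_minus_left: "(- a) *\<^sub>C x = - (a *\<^sub>C (x::'a::complex_inner))"
  using scaleC_add_left[of "- a" a x] by (simp add: eq_neg_iff_add_eq_0)

lemma scaleC_minus_right: "a *\<^sub>C (- x) = - (a *\<^sub>C (x::'a::complex_inner))"
  using scaleC_add_right[of a "- x" x] by (simp add: eq_neg_iff_add_eq_0)

lemma scaleC_diff_right: "a *\<^sub>C (x - y) = a *\<^sub>C x - a *\<^sub>C (y::'a::complex_inner)"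
  using scaleC_add_right[of a x "- y"] by (simp add: scaleC_minus_right)

lemma minus_scaleC: "- x = (- 1) *\<^sub>C (x::'a::complex_inner)"
  by (simp add: scaleC_minus_left)

lemma cinner_add_right: "cinner x (y + z) = cinner x y + cinner (x::'a::complex_inner) z"
  by (metis cinner_add_left cinner_commute complex_cnj_add)

lemma cinner_scaleC_right: "cinner x (a *\<^sub>C y) = cnj a * cinner (x::'a::complex_inner) y"
  by (metis cinner_commute cinner_scaleC_left complex_cnj_mult)

lemma cinner_zero_left [simp]: "cinner 0 (x::'a::complex_inner) = 0"
  using cinner_add_left[of 0 0 x] by simp

lemma cinner_zero_right [simp]: "cinner (x::'a::complex_inner) 0 = 0"
  using cinner_add_right[of x 0 0] by simp

lemma cinner_minus_left: "cinner (- x) y = - cinner (x::'a::complex_inner) y"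
  using cinner_add_left[of "- x" x y] by (simp add: eq_neg_iff_add_eq_0)

lemma cinner_minus_right: "cinner x (- y) = - cinner (x::'a::complex_inner) y"
  using cinner_add_right[of x "- y" y] by (simp add: eq_neg_iff_add_eq_0)

lemma cinner_diff_left: "cinner (x - y) z = cinner x z - cinner (y::'a::complex_inner) z"
  using cinner_add_left[of x "- y" z] by (simp add: cinner_minus_left)

lemma cinner_diff_right: "cinner x (y - z) = cinner x y - cinner (x::'a::complex_inner) z"
  using cinner_add_right[of x y "- z"] by (simp add: cinner_minus_right)

lemmas cinner_simps = cinner_add_left cinner_add_right cinner_diff_left cinner_diff_right
  cinner_minus_left cinner_minus_right cinner_scaleC_left cinner_scaleC_right

lemma Re_cinner_commute: "Re (cinner y x) = Re (cinner (x::'a::complex_inner) y)"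
  by (subst cinner_commute) simp

lemma power2_norm_add:
  "(norm (x + y))\<^sup>2 = (norm x)\<^sup>2 + 2 * Re (cinner x y) + (norm (y::'a::complex_inner))\<^sup>2"
proof -
  have "complex_of_real ((norm (x + y))\<^sup>2) = cinner (x + y) (x + y)"
    by (simp only: cinner_self)
  also have "\<dots> = complex_of_real ((norm x)\<^sup>2) + (cinner x y + cinner y x)
      + complex_of_real ((norm y)\<^sup>2)"
    by (simp only: cinner_add_left cinner_add_right cinner_self[symmetric] ac_simps)
  finally have "Re (complex_of_real ((norm (x + y))\<^sup>2)) =
      Re (complex_of_real ((norm x)\<^sup>2) + (cinner x y + cinner y x) + complex_of_real ((norm y)\<^sup>2))"
    by simp
  then show ?thesis
    using Re_cinner_commute[of y x] by simp
qed

lemma norm_scaleC: "norm (a *\<^sub>C x) = cmod a * norm (x::'a::complex_inner)"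
proof -
  have "complex_of_real ((norm (a *\<^sub>C x))\<^sup>2) = (a * cnj a) * complex_of_real ((norm x)\<^sup>2)"
    by (simp only: cinner_self[symmetric] cinner_scaleC_left cinner_scaleC_right
        mult.assoc mult.left_commute)
  also have "\<dots> = complex_of_real ((cmod a * norm x)\<^sup>2)"
    by (simp add: complex_norm_square[symmetric] power_mult_distrib)
  finally have "(norm (a *\<^sub>C x))\<^sup>2 = (cmod a * norm x)\<^sup>2"
    using of_real_eq_iff by blast
  then show ?thesis
    by simp
qed

lemma Re_cinner_le: "Re (cinner x y) \<le> norm x * norm (y::'a::complex_inner)"
proof -
  have "(norm (x + y))\<^sup>2 \<le> (norm x + norm y)\<^sup>2"
    by (simp add: norm_triangle_ineq power_mono)
  then show ?thesis
    by (simp add: power2_norm_add power2_sum)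
qed

lemma Im_cinner: "Im (cinner x y) = - Re (cinner (\<i> *\<^sub>C x) (y::'a::complex_inner))"
  by (simp add: cinner_scaleC_left)

text \<open>
  A Cauchy--Schwarz inequality with a lossy constant: the bounds of the real and the imaginary part,
  both read off from the triangle inequality of the norm, are added. Only continuity and the
  order of magnitude matter below.
\<close>

lemma norm_cinner_le: "cmod (cinner x y) \<le> norm x * norm (y::'a::complex_inner) * 2"
proof -
  have "\<bar>Re (cinner x y)\<bar> \<le> norm x * norm y" for x y :: 'a
    using Re_cinner_le[of x y] Re_cinner_le[of "- x" y] by (simp add: cinner_minus_left)
  then have "\<bar>Re (cinner x y)\<bar> \<le> norm x * norm y" "\<bar>Im (cinner x y)\<bar> \<le> norm x * norm y"
    by (auto simp: Im_cinner norm_scaleC dest: spec[of _ "\<i> *\<^sub>C x"])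
      (metis norm_scaleC norm_ii mult_1)
  then show ?thesis
    using cmod_le[of "cinner x y"] by linarith
qed

lemma bounded_bilinear_cinner:
  "bounded_bilinear (cinner :: 'a::complex_inner \<Rightarrow> 'a \<Rightarrow> complex)"
proof
  show "\<exists>K. \<forall>x y :: 'a. cmod (cinner x y) \<le> norm x * norm y * K"
    using norm_cinner_le by blast
qed (simp_all add: cinner_simps scaleR_scaleC scaleR_conv_of_real)

lemma bounded_bilinear_scaleC:
  "bounded_bilinear (scaleC :: complex \<Rightarrow> 'a::complex_inner \<Rightarrow> 'a)"
proof
  show "\<exists>K. \<forall>a (x::'a). norm (a *\<^sub>C x) \<le> norm a * norm x * K"
    by (rule exI[of _ 1]) (simp add: norm_scaleC)
qed (simp_all add: scaleC_add_left scaleC_add_right scaleR_scaleC scaleC_scaleC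
      scaleR_conv_of_real mult.commute)

lemmas tendsto_cinner = bounded_bilinear.tendsto[OF bounded_bilinear_cinner]
lemmas tendsto_scaleC = bounded_bilinear.tendsto[OF bounded_bilinear_scaleC]

section \<open>Orthogonal projection\<close>

lemma real_eq_0_if_affine_nonneg:
  fixes b c :: real
  assumes "\<And>t. 0 \<le> c + t * b"
  shows "b = 0"
proof (rule ccontr)
  assume "b \<noteq> 0"
  then have "c + (- (c + 1) / b) * b = - 1"
    by simp
  then show False
    using assms[of "- (c + 1) / b"] by linarith
qed

lemma complex_eq_0_if_affine_Im_nonneg:
  fixes z :: complex and c :: real
  assumes "\<And>a. 0 \<le> c + Im (a * z)"
  shows "z = 0"
proof -
  have "Im z = 0"
    by (rule real_eq_0_if_affine_nonneg[of c])
      (use assms[of "complex_of_real _"] in simp)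
  moreover have "Re z = 0"
    by (rule real_eq_0_if_affine_nonneg[of c])
      (use assms[of "\<i> * complex_of_real _"] in simp)
  ultimately show ?thesis
    by (simp add: complex_eq_iff)
qed

lemma parallelogram:
  "(norm (x - y))\<^sup>2 = 2 * (norm x)\<^sup>2 + 2 * (norm y)\<^sup>2 - (norm (x + (y::'a::complex_inner)))\<^sup>2"
  using power2_norm_add[of x y] power2_norm_add[of x "- y"] by (simp add: cinner_minus_right)

text \<open>
  By the parallelogram law, a sequence in \<open>V\<close> that minimizes the distance to \<open>x\<close> is Cauchy; at its
  limit \<open>p\<close> the first variation of the distance vanishes.
\<close>

lemma orthogonal_projection:
  fixes V :: "'a::chilbert_space set"
  assumes "closed V" and zero: "0 \<in> V"
    and add: "\<And>u v. u \<in> V \<Longrightarrow> v \<in> V \<Longrightarrow> u + v \<in> V"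
    and scale: "\<And>a v. v \<in> V \<Longrightarrow> a *\<^sub>C v \<in> V"
  obtains p where "p \<in> V" "x - p \<in> ortho_compl V"
proof -
  define d where "d = (INF v\<in>V. (norm (x - v))\<^sup>2)"
  have bdd: "bdd_below ((\<lambda>v. (norm (x - v))\<^sup>2) ` V)"
    by (rule bdd_belowI[of _ 0]) auto
  have d_le: "d \<le> (norm (x - v))\<^sup>2" if "v \<in> V" for v
    unfolding d_def using bdd that by (rule cINF_lower)
  have "\<exists>v\<in>V. (norm (x - v))\<^sup>2 < d + inverse (real (Suc n))" for n
    using cINF_less_iff[OF _ bdd, of "d + inverse (real (Suc n))"] zero
    unfolding d_def[symmetric] by auto
  then obtain v where vV: "\<And>n. v n \<in> V"
    and v_lt: "\<And>n. (norm (x - v n))\<^sup>2 < d + inverse (real (Suc n))"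
    by metis
  have dist_le: "(norm (v m - v n))\<^sup>2 \<le> 2 * inverse (real (Suc m)) + 2 * inverse (real (Suc n))"
    for m n
  proof -
    have "(1/2) *\<^sub>R (v m + v n) \<in> V"
      using vV add scale by (simp add: scaleR_scaleC)
    moreover have "(x - v n) + (x - v m) = 2 *\<^sub>R (x - (1/2) *\<^sub>R (v m + v n))"
      by (simp add: scaleR_diff_right scaleR_2)
    ultimately have "4 * d \<le> (norm ((x - v n) + (x - v m)))\<^sup>2"
      using d_le by (simp add: power_mult_distrib)
    then show ?thesis
      using parallelogram[of "x - v n" "x - v m"] v_lt[of m] v_lt[of n] by simp
  qed
  have "Cauchy v"
  proof (rule CauchyI)
    fix e :: real
    assume "0 < e"
    then have "0 < e\<^sup>2 / 4"
      by simp
    then obtain N where N: "inverse (real (Suc N)) < e\<^sup>2 / 4"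
      using reals_Archimedean by blast
    show "\<exists>M. \<forall>m\<ge>M. \<forall>n\<ge>M. norm (v m - v n) < e"
    proof (intro exI allI impI)
      fix m n
      assume "N \<le> m" "N \<le> n"
      then have "inverse (real (Suc m)) \<le> inverse (real (Suc N))"
        "inverse (real (Suc n)) \<le> inverse (real (Suc N))"
        by (simp_all add: le_imp_inverse_le)
      then have "(norm (v m - v n))\<^sup>2 < e\<^sup>2"
        using dist_le[of m n] N by linarith
      then show "norm (v m - v n) < e"
        using \<open>0 < e\<close> by (simp add: power_less_imp_less_base)
    qed
  qed
  then obtain p where lim: "v \<longlonglongrightarrow> p"
    using Cauchy_convergent convergent_def by blast
  have "p \<in> V"
    using closed_sequentially[OF \<open>closed V\<close>] vV lim by blast
  have p_le: "(norm (x - p))\<^sup>2 \<le> d"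
  proof (rule LIMSEQ_le)
    show "(\<lambda>n. (norm (x - v n))\<^sup>2) \<longlonglongrightarrow> (norm (x - p))\<^sup>2"
      by (intro tendsto_intros lim)
    show "(\<lambda>n. d + inverse (real (Suc n))) \<longlonglongrightarrow> d"
      using tendsto_add[OF tendsto_const LIMSEQ_inverse_real_of_nat, of d] by simp
    show "\<exists>N. \<forall>n\<ge>N. (norm (x - v n))\<^sup>2 \<le> d + inverse (real (Suc n))"
      using v_lt less_imp_le by blast
  qed
  have min: "(norm (x - p))\<^sup>2 \<le> (norm (x - p + u))\<^sup>2" if "u \<in> V" for u
  proof -
    have "p - u \<in> V"
      using add[OF \<open>p \<in> V\<close> scale[OF that, of "-1"]] by (simp add: minus_scaleC[symmetric])
    then have "d \<le> (norm (x - p + u))\<^sup>2"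
      using d_le[of "p - u"] by (simp only: diff_diff_eq2 diff_add_eq)
    with p_le show ?thesis
      by (rule order_trans)
  qed
  have Re0: "Re (cinner u (x - p)) = 0" if "u \<in> V" for u
  proof (rule ccontr)
    let ?r = "Re (cinner u (x - p))"
    assume "?r \<noteq> 0"
    then have "u \<noteq> 0"
      by auto
    \<comment> \<open>Moving from \<open>x - p\<close> by this multiple of \<open>u\<close> would decrease the norm the most.\<close>
    define t where "t = - ?r / (norm u)\<^sup>2"
    have "(norm (x - p + t *\<^sub>R u))\<^sup>2 = (norm (x - p))\<^sup>2 + 2 * t * ?r + t\<^sup>2 * (norm u)\<^sup>2"
      using power2_norm_add[of "x - p" "t *\<^sub>R u"] Re_cinner_commute[of u "x - p"]
      by (simp add: scaleR_scaleC cinner_scaleC_right norm_scaleC power_mult_distrib)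
    also have "\<dots> = (norm (x - p))\<^sup>2 - ?r\<^sup>2 / (norm u)\<^sup>2"
      using \<open>u \<noteq> 0\<close> by (simp add: t_def field_simps power2_eq_square)
    finally have "(norm (x - p + t *\<^sub>R u))\<^sup>2 < (norm (x - p))\<^sup>2"
      using \<open>?r \<noteq> 0\<close> \<open>u \<noteq> 0\<close> by simp
    then show False
      using min[of "t *\<^sub>R u"] scale[OF that] by (metis scaleR_scaleC not_less)
  qed
  have "cinner u (x - p) = 0" if "u \<in> V" for u
    using Re0[OF that] Re0[OF scale[OF that, of \<i>]] by (simp add: complex_eq_iff Im_cinner)
  then have "x - p \<in> ortho_compl V"
    by (simp add: ortho_compl_def)
  with \<open>p \<in> V\<close> show thesis
    by (rule that)
qed

section \<open>Linear relations and their adjoints\<close>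

text \<open>
  Adjoints, sums and unions of chains of operators are first of all linear relations. Single-valuedness
  is left out here and recovered for symmetric relations with dense domain
  (\<open>linear_op_if_subset_op_adjoint\<close>).
\<close>

definition linear_graph :: "'a::complex_inner graph \<Rightarrow> bool" where
  "linear_graph T \<longleftrightarrow> (0, 0) \<in> T \<and>
     (\<forall>f f' g g'. (f, f') \<in> T \<longrightarrow> (g, g') \<in> T \<longrightarrow> (f + g, f' + g') \<in> T) \<and>
     (\<forall>a f f'. (f, f') \<in> T \<longrightarrow> (a *\<^sub>C f, a *\<^sub>C f') \<in> T)"

lemma linear_op_iff: "linear_op T \<longleftrightarrow> single_valued T \<and> linear_graph T"
  unfolding linear_op_def linear_graph_def by fastforce

lemma linear_graph_zero: "linear_graph T \<Longrightarrow> (0, 0) \<in> T"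
  and linear_graph_add: "linear_graph T \<Longrightarrow> (f, f') \<in> T \<Longrightarrow> (g, g') \<in> T \<Longrightarrow> (f + g, f' + g') \<in> T"
  and linear_graph_scale: "linear_graph T \<Longrightarrow> (f, f') \<in> T \<Longrightarrow> (a *\<^sub>C f, a *\<^sub>C f') \<in> T"
  by (auto simp: linear_graph_def)

lemma linear_graph_diff:
  assumes "linear_graph T" "(f, f') \<in> T" "(g, g') \<in> T"
  shows "(f - g, f' - g') \<in> T"
  using linear_graph_add[OF assms(1,2) linear_graph_scale[OF assms(1,3), of "-1"]]
  by (simp add: scaleC_minus_left)

text \<open>
  The sum \<open>S + T\<close> of relations is the elementwise sum of sets of pairs, that is, the span of the
  two graphs; it is not the sum of operators, which adds values at a common argument.
\<close>

lemma linear_graph_plus: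
  assumes "linear_graph S" "linear_graph T"
  shows "linear_graph (S + T)"
  unfolding linear_graph_def
proof (intro conjI allI impI)
  show "(0, 0) \<in> S + T"
    using set_plus_intro[OF assms[THEN linear_graph_zero]] by simp
next
  fix f f' g g'
  assume "(f, f') \<in> S + T" "(g, g') \<in> S + T"
  then obtain a a' b b' c c' d d' where
    "(a, a') \<in> S" "(b, b') \<in> T" "(c, c') \<in> S" "(d, d') \<in> T"
    "f = a + b" "f' = a' + b'" "g = c + d" "g' = c' + d'"
    by (auto elim!: set_plus_elim)
  then show "(f + g, f' + g') \<in> S + T"
    using set_plus_intro[of "(a + c, a' + c')" S "(b + d, b' + d')" T]
      assms[THEN linear_graph_add] by (simp add: ac_simps)
next
  fix r f f'
  assume "(f, f') \<in> S + T"
  then obtain a a' b b' where "(a, a') \<in> S" "(b, b') \<in> T" "f = a + b" "f' = a' + b'"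
    by (auto elim!: set_plus_elim)
  then show "(r *\<^sub>C f, r *\<^sub>C f') \<in> S + T"
    using set_plus_intro[of "(r *\<^sub>C a, r *\<^sub>C a')" S "(r *\<^sub>C b, r *\<^sub>C b')" T]
      assms[THEN linear_graph_scale] by (simp add: scaleC_add_right)
qed

lemma linear_graph_range_scaleC: "linear_graph (range (\<lambda>a. (a *\<^sub>C h, a *\<^sub>C h')))"
  unfolding linear_graph_def
proof (intro conjI allI impI)
  show "(0, 0) \<in> range (\<lambda>a. (a *\<^sub>C h, a *\<^sub>C h'))"
    by (rule range_eqI[of _ _ 0]) simp
qed (auto simp: scaleC_add_left[symmetric] scaleC_scaleC)

lemma plus_subset:
  assumes "linear_graph E" "S \<subseteq> E" "T \<subseteq> E"
  shows "S + T \<subseteq> E"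
  using assms linear_graph_add by (fastforce elim!: set_plus_elim)

lemma subset_plus:
  assumes "linear_graph S" "linear_graph T"
  shows "S \<subseteq> S + T" "T \<subseteq> S + T"
  using set_zero_plus2[of S T] set_zero_plus2[of T S] assms[THEN linear_graph_zero]
  by (simp_all add: zero_prod_def add.commute)

lemma op_adjoint_iff:
  "(g, g') \<in> op_adjoint T \<longleftrightarrow> (\<forall>f f'. (f, f') \<in> T \<longrightarrow> cinner f' g = cinner f g')"
  by (auto simp: op_adjoint_def)

lemma op_adjointD: "(g, g') \<in> op_adjoint T \<Longrightarrow> (f, f') \<in> T \<Longrightarrow> cinner f' g = cinner f g'"
  by (simp add: op_adjoint_iff)

lemma op_adjoint_antimono: "S \<subseteq> T \<Longrightarrow> op_adjoint T \<subseteq> op_adjoint S"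
  by (rule subrelI) (simp add: op_adjoint_iff subset_iff)

lemma subset_op_adjoint_commute: "S \<subseteq> op_adjoint T \<longleftrightarrow> T \<subseteq> op_adjoint S"
proof -
  have "T \<subseteq> op_adjoint S" if "S \<subseteq> op_adjoint T" for S T :: "'a graph"
  proof clarify
    fix g g'
    assume g: "(g, g') \<in> T"
    have "cinner f' g = cinner f g'" if "(f, f') \<in> S" for f f'
      using op_adjointD[of f f' T g g'] \<open>S \<subseteq> op_adjoint T\<close> that g
      by (metis cinner_commute subsetD)
    then show "(g, g') \<in> op_adjoint S"
      by (simp add: op_adjoint_iff)
  qed
  then show ?thesis
    by blast
qed

lemma linear_graph_op_adjoint: "linear_graph (op_adjoint T)"
  by (simp add: linear_graph_def op_adjoint_iff cinner_simps)

lemma op_adjoint_plus: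
  assumes "linear_graph S" "linear_graph T"
  shows "op_adjoint (S + T) = op_adjoint S \<inter> op_adjoint T"
proof
  show "op_adjoint (S + T) \<subseteq> op_adjoint S \<inter> op_adjoint T"
    using subset_plus[OF assms] op_adjoint_antimono by blast
  show "op_adjoint S \<inter> op_adjoint T \<subseteq> op_adjoint (S + T)"
    by (auto simp: op_adjoint_iff cinner_simps elim!: set_plus_elim)
qed

lemma plus_subset_op_adjoint:
  assumes "linear_graph S" "linear_graph T"
    and "S \<subseteq> op_adjoint S" "T \<subseteq> op_adjoint T" "T \<subseteq> op_adjoint S"
  shows "S + T \<subseteq> op_adjoint (S + T)"
  unfolding op_adjoint_plus[OF assms(1,2)]
  using assms subset_op_adjoint_commute[of S T]
  by (intro Int_greatest plus_subset linear_graph_op_adjoint) auto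

lemma single_valued_op_adjoint:
  assumes "densely_defined T"
  shows "single_valued (op_adjoint T)"
proof (rule single_valuedI)
  fix g g' g''
  assume "(g, g') \<in> op_adjoint T" "(g, g'') \<in> op_adjoint T"
  then have "Domain T \<subseteq> {f. cinner f (g' - g'') = 0}"
    by (auto simp: op_adjoint_iff cinner_diff_right)
  moreover have "closed {f. cinner f (g' - g'') = 0}"
    by (intro closed_Collect_eq continuous_intros
        bounded_bilinear.continuous_on[OF bounded_bilinear_cinner])
  ultimately have "UNIV \<subseteq> {f. cinner f (g' - g'') = 0}"
    using assms closure_minimal unfolding densely_defined_def by metis
  then have "cinner (g' - g'') (g' - g'') = 0"
    by blast
  then show "g' = g''"
    by (simp add: cinner_self)
qed

lemma densely_defined_mono: "densely_defined S \<Longrightarrow> S \<subseteq> T \<Longrightarrow> densely_defined T"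
  unfolding densely_defined_def by (metis Domain_mono closure_mono top.extremum_uniqueI)

lemma linear_op_if_subset_op_adjoint:
  assumes "linear_graph T" "densely_defined T" "T \<subseteq> op_adjoint T"
  shows "linear_op T"
  using assms single_valued_op_adjoint single_valued_subset linear_op_iff by blast

lemma symmetric_op_iff:
  "symmetric_op T \<longleftrightarrow> linear_op T \<and> densely_defined T \<and> T \<subseteq> op_adjoint T"
  unfolding symmetric_op_def op_adjoint_def by fast

lemma Im_cinner_eq_0_if_subset_op_adjoint:
  assumes "T \<subseteq> op_adjoint T" "(f, f') \<in> T"
  shows "Im (cinner f' f) = 0"
proof -
  have "cinner f' f = cinner f f'"
    using assms op_adjointD by blast
  also have "\<dots> = cnj (cinner f' f)"
    by (rule cinner_commute)
  finally show ?thesis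
    by (simp add: complex_eq_iff)
qed

lemma nonreal_eigenvector_eq_0:
  assumes "T \<subseteq> op_adjoint T" "(g, \<nu> *\<^sub>C g) \<in> T" "Im \<nu> \<noteq> 0"
  shows "g = 0"
proof -
  have "Im (\<nu> * complex_of_real ((norm g)\<^sup>2)) = 0"
    using Im_cinner_eq_0_if_subset_op_adjoint[OF assms(1,2)]
    by (simp only: cinner_scaleC_left cinner_self)
  then show ?thesis
    using assms(3) by (simp del: of_real_power)
qed

text \<open>
  As \<open>\<langle>T f, f\<rangle>\<close> is real, the imaginary part of \<open>\<langle>(T - \<nu>) f, f\<rangle>\<close> is
  \<open>- Im \<nu> \<cdot> \<parallel>f\<parallel>\<^sup>2\<close>; the factor 2 is the constant of \<open>norm_cinner_le\<close>.
\<close>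

lemma Im_norm_le_norm_op_shift:
  assumes "T \<subseteq> op_adjoint T" "(f, f') \<in> T"
  shows "\<bar>Im \<nu>\<bar> * norm f \<le> 2 * norm (f' - \<nu> *\<^sub>C f)"
proof (cases "f = 0")
  case False
  have "Im (cinner (f' - \<nu> *\<^sub>C f) f) = - Im \<nu> * (norm f)\<^sup>2"
    using Im_cinner_eq_0_if_subset_op_adjoint[OF assms]
    by (simp add: cinner_simps cinner_self del: of_real_power)
  then have "\<bar>Im \<nu>\<bar> * (norm f)\<^sup>2 \<le> norm (f' - \<nu> *\<^sub>C f) * norm f * 2"
    using abs_Im_le_cmod[of "cinner (f' - \<nu> *\<^sub>C f) f"] norm_cinner_le[of "f' - \<nu> *\<^sub>C f" f]
    by (simp add: abs_mult)
  then have "(\<bar>Im \<nu>\<bar> * norm f) * norm f \<le> (2 * norm (f' - \<nu> *\<^sub>C f)) * norm f"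
    by (simp add: power2_eq_square ac_simps)
  then show ?thesis
    using False by simp
qed simp

lemma op_adjoint_sequentially_closed:
  assumes "\<And>n. (f n, f' n) \<in> op_adjoint T" "f \<longlonglongrightarrow> g" "f' \<longlonglongrightarrow> g'"
  shows "(g, g') \<in> op_adjoint T"
  unfolding op_adjoint_iff
proof (intro allI impI)
  fix h h'
  assume h: "(h, h') \<in> T"
  have "(\<lambda>n. cinner h' (f n)) \<longlonglongrightarrow> cinner h' g"
    by (intro tendsto_cinner tendsto_const assms)
  moreover have "cinner h' (f n) = cinner h (f' n)" for n
    using assms(1) h op_adjointD by blast
  moreover have "(\<lambda>n. cinner h (f' n)) \<longlonglongrightarrow> cinner h g'"
    by (intro tendsto_cinner tendsto_const assms)
  ultimately show "cinner h' g = cinner h g'"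
    using LIMSEQ_unique by simp
qed

lemma deficiency_space_iff: "g \<in> deficiency_space T \<mu> \<longleftrightarrow> (g, \<mu> *\<^sub>C g) \<in> op_adjoint T"
proof -
  have "g \<in> deficiency_space T \<mu> \<longleftrightarrow> (\<forall>f f'. (f, f') \<in> T \<longrightarrow> cinner (f' - cnj \<mu> *\<^sub>C f) g = 0)"
    by (auto simp: deficiency_space_def ortho_compl_def op_shift_def Range_iff)
  then show ?thesis
    by (simp add: op_adjoint_iff cinner_simps)
qed

section \<open>Self-adjoint operators\<close>

text \<open>
  The lower bound \<open>Im_norm_le_norm_op_shift\<close> makes the range of \<open>B - \<nu>\<close> closed, and a vector orthogonal
  to the range is an eigenvector of \<open>B\<^sup>* = B\<close> for the nonreal number \<open>cnj \<nu>\<close>, hence zero.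
\<close>

lemma self_adjoint_shift_surj:
  fixes B :: "'a::chilbert_space graph"
  assumes "self_adjoint B" "Im \<nu> \<noteq> 0"
  obtains f f' where "(f, f') \<in> B" "f' - \<nu> *\<^sub>C f = y"
proof -
  have lin: "linear_graph B" and B: "op_adjoint B = B"
    using assms(1) by (auto simp: self_adjoint_def linear_op_iff)
  then have sym: "B \<subseteq> op_adjoint B"
    by simp
  define R where "R = Range (op_shift B \<nu>)"
  have R_iff: "z \<in> R \<longleftrightarrow> (\<exists>f f'. (f, f') \<in> B \<and> f' - \<nu> *\<^sub>C f = z)" for z
    by (auto simp: R_def op_shift_def Range_iff)
  have "closed R"
    unfolding closed_sequential_limits
  proof (intro allI impI, elim conjE)
    fix z l
    assume "\<forall>n. z n \<in> R" and lim: "z \<longlonglongrightarrow> l"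
    then obtain f f' where fB: "\<And>n. (f n, f' n) \<in> B" and z: "\<And>n. f' n - \<nu> *\<^sub>C f n = z n"
      unfolding R_iff by metis
    have f_le: "norm (f m - f n) \<le> 2 / \<bar>Im \<nu>\<bar> * norm (z m - z n)" for m n
    proof -
      have "(f' m - f' n) - \<nu> *\<^sub>C (f m - f n) = z m - z n"
        by (simp add: z[symmetric] scaleC_diff_right)
      then have "\<bar>Im \<nu>\<bar> * norm (f m - f n) \<le> 2 * norm (z m - z n)"
        using Im_norm_le_norm_op_shift[OF sym linear_graph_diff[OF lin fB fB]] by metis
      then show ?thesis
        using assms(2) by (simp add: field_simps)
    qed
    have "Cauchy f"
    proof (rule CauchyI)
      fix e :: real
      assume "0 < e"
      then have "0 < e * \<bar>Im \<nu>\<bar> / 2"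
        using assms(2) by simp
      then obtain M where M: "\<forall>m\<ge>M. \<forall>n\<ge>M. norm (z m - z n) < e * \<bar>Im \<nu>\<bar> / 2"
        using LIMSEQ_imp_Cauchy[OF lim] CauchyD by blast
      have "norm (f m - f n) < e" if "m \<ge> M" "n \<ge> M" for m n
      proof -
        have "2 / \<bar>Im \<nu>\<bar> * norm (z m - z n) < e"
          using M that assms(2) by (simp add: field_simps)
        then show ?thesis
          using f_le[of m n] by linarith
      qed
      then show "\<exists>M. \<forall>m\<ge>M. \<forall>n\<ge>M. norm (f m - f n) < e"
        by blast
    qed
    then obtain g where g: "f \<longlonglongrightarrow> g"
      using Cauchy_convergent convergent_def by blast
    then have "(\<lambda>n. z n + \<nu> *\<^sub>C f n) \<longlonglongrightarrow> l + \<nu> *\<^sub>C g"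
      by (intro tendsto_add lim tendsto_scaleC tendsto_const)
    then have "f' \<longlonglongrightarrow> l + \<nu> *\<^sub>C g"
      by (simp add: z[symmetric])
    then have "(g, l + \<nu> *\<^sub>C g) \<in> B"
      using op_adjoint_sequentially_closed[of f f' B, OF _ g] fB B by simp
    then show "l \<in> R"
      unfolding R_iff by force
  qed
  have "0 \<in> R"
    unfolding R_iff using linear_graph_zero[OF lin] by (intro exI[of _ 0]) simp
  have R_add: "u + v \<in> R" if uv: "u \<in> R" "v \<in> R" for u v
  proof -
    obtain f f' g g' where "(f, f') \<in> B" "f' - \<nu> *\<^sub>C f = u" "(g, g') \<in> B" "g' - \<nu> *\<^sub>C g = v"
      using uv unfolding R_iff by metis
    then have "(f + g, f' + g') \<in> B" "(f' + g') - \<nu> *\<^sub>C (f + g) = u + v"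
      using linear_graph_add[OF lin] by (simp, force simp: scaleC_add_right)
    then show ?thesis
      unfolding R_iff by blast
  qed
  have R_scale: "a *\<^sub>C v \<in> R" if v: "v \<in> R" for a v
  proof -
    obtain g g' where "(g, g') \<in> B" "g' - \<nu> *\<^sub>C g = v"
      using v unfolding R_iff by metis
    then have "(a *\<^sub>C g, a *\<^sub>C g') \<in> B" "a *\<^sub>C g' - \<nu> *\<^sub>C (a *\<^sub>C g) = a *\<^sub>C v"
      using linear_graph_scale[OF lin]
      by (simp, force simp: scaleC_diff_right scaleC_scaleC mult.commute)
    then show ?thesis
      unfolding R_iff by blast
  qed
  obtain p where "p \<in> R" "y - p \<in> ortho_compl R"
    using orthogonal_projection[OF \<open>closed R\<close> \<open>0 \<in> R\<close> R_add R_scale] .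
  have "y - p = 0"
  proof (rule nonreal_eigenvector_eq_0[OF sym])
    show "(y - p, cnj \<nu> *\<^sub>C (y - p)) \<in> B"
      using deficiency_space_iff[of "y - p" B "cnj \<nu>"] B \<open>y - p \<in> ortho_compl R\<close>
      by (simp add: deficiency_space_def R_def)
    show "Im (cnj \<nu>) \<noteq> 0"
      using assms(2) by simp
  qed
  with \<open>p \<in> R\<close> have "y \<in> R"
    by simp
  then show thesis
    using that unfolding R_iff by blast
qed

text \<open>
  Since \<open>B - \<nu>\<close> is onto, an element \<open>(g, g')\<close> of \<open>E\<close> has the same image under \<open>E - \<nu>\<close> as some element
  of \<open>B\<close>; their difference is an eigenvector of \<open>E\<close> for \<open>\<nu>\<close>.
\<close>

lemma self_adjoint_eq_if_subset:
  fixes B :: "'a::chilbert_space graph"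
  assumes "self_adjoint B" "B \<subseteq> E" "linear_graph E" "Im \<nu> \<noteq> 0"
    and no_eigen: "\<And>g. (g, \<nu> *\<^sub>C g) \<in> E \<Longrightarrow> g = 0"
  shows "E = B"
proof
  show "E \<subseteq> B"
  proof clarify
    fix g g'
    assume g: "(g, g') \<in> E"
    obtain h h' where h: "(h, h') \<in> B" "h' - \<nu> *\<^sub>C h = g' - \<nu> *\<^sub>C g"
      using self_adjoint_shift_surj[OF assms(1,4)] by blast
    have "g' - h' = \<nu> *\<^sub>C (g - h)"
      using h(2) by (simp add: scaleC_diff_right algebra_simps)
    then have "(g - h, \<nu> *\<^sub>C (g - h)) \<in> E"
      using linear_graph_diff[OF assms(3) g] h(1) assms(2) by force
    then have "g = h"
      using no_eigen by force
    with h show "(g, g') \<in> B"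
      by simp
  qed
qed (rule assms(2))

text \<open>
  Move an element \<open>(g, g')\<close> of \<open>T\<close> by a multiple \<open>a\<close> of \<open>(f, f')\<close> in \<open>S\<close>. The quadratic term in
  \<open>Im \<langle>g' + a f', g + a f\<rangle>\<close> vanishes because \<open>S\<close> is symmetric. What remains is real-affine in the
  arbitrary complex number \<open>a\<close> and bounded below, so its linear part, whose coefficient is
  \<open>\<langle>f', g\<rangle> - \<langle>f, g'\<rangle>\<close>, vanishes.
\<close>

lemma dissipative_ext_subset_op_adjoint:
  assumes "S \<subseteq> op_adjoint S" "linear_graph S" "dissipative T" "S \<subseteq> T"
  shows "T \<subseteq> op_adjoint S"
proof clarify
  fix g g'
  assume g: "(g, g') \<in> T"
  have lin: "linear_graph T" and diss: "\<And>f f'. (f, f') \<in> T \<Longrightarrow> 0 \<le> Im (cinner f' f)"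
    using assms(3) by (auto simp: dissipative_def linear_op_iff)
  have "cinner f' g - cinner f g' = 0" if f: "(f, f') \<in> S" for f f'
  proof (rule complex_eq_0_if_affine_Im_nonneg[of "Im (cinner g' g)"])
    fix a
    have af: "(a *\<^sub>C f, a *\<^sub>C f') \<in> S"
      using linear_graph_scale assms(2) f by blast
    then have "0 \<le> Im (cinner (g' + a *\<^sub>C f') (g + a *\<^sub>C f))"
      using diss linear_graph_add[OF lin g] assms(4) by blast
    also have "\<dots> = Im (cinner g' g) + Im (a * (cinner f' g - cinner f g'))"
      using Im_cinner_eq_0_if_subset_op_adjoint[OF assms(1) af] cinner_commute[of g' f]
      by (simp add: cinner_simps algebra_simps)
    finally show "0 \<le> Im (cinner g' g) + Im (a * (cinner f' g - cinner f g'))" .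
  qed
  then show "(g, g') \<in> op_adjoint S"
    by (simp add: op_adjoint_iff)
qed

lemma maximal_dissipative_if_self_adjoint:
  assumes "self_adjoint B"
  shows "maximal_dissipative B"
proof -
  have B: "linear_op B" "op_adjoint B = B"
    using assms by (auto simp: self_adjoint_def)
  then have "dissipative B"
    using Im_cinner_eq_0_if_subset_op_adjoint[of B] by (force simp: dissipative_def)
  moreover have "T \<subseteq> B" if "dissipative T" "B \<subseteq> T" for T
    using dissipative_ext_subset_op_adjoint[of B T] B that by (simp add: linear_op_iff)
  ultimately show ?thesis
    unfolding maximal_dissipative_def by blast
qed

section \<open>Conjugations\<close>

context
  fixes C :: "'a::complex_inner \<Rightarrow> 'a"
  assumes C: "conjugation C"
begin

lemma conjugation_add: "C (x + y) = C x + C y"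
  and conjugation_scaleC: "C (a *\<^sub>C x) = cnj a *\<^sub>C C x"
  and norm_conjugation: "norm (C x) = norm x"
  and conjugation_conjugation: "C (C x) = x"
  using C by (auto simp: conjugation_def)

lemma conjugation_diff: "C (x - y) = C x - C y"
  using conjugation_add[of "x - y" y] by simp

text \<open>By polarization, since an isometry preserves the real part of the inner product.\<close>

lemma cinner_conjugation: "cinner (C x) (C y) = cinner y x"
proof -
  have Re: "Re (cinner (C u) (C v)) = Re (cinner u v)" for u v
    using power2_norm_add[of u v] power2_norm_add[of "C u" "C v"]
    by (simp add: conjugation_add[symmetric] norm_conjugation)
  have "Im (cinner (C x) (C y)) = Re (cinner (C (\<i> *\<^sub>C x)) (C y))"
    by (simp add: conjugation_scaleC cinner_scaleC_left)
  also have "\<dots> = - Im (cinner x y)"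
    by (simp add: Re cinner_scaleC_left)
  finally have "cinner (C x) (C y) = cnj (cinner x y)"
    by (simp add: complex_eq_iff Re)
  then show ?thesis
    using cinner_commute[of y x] by simp
qed

lemma conj_by_iff: "(f, g) \<in> conj_by C T \<longleftrightarrow> (C f, C g) \<in> T"
proof
  assume "(C f, C g) \<in> T"
  then show "(f, g) \<in> conj_by C T"
    unfolding conj_by_def by (intro CollectI exI[of _ f] exI[of _ "C g"])
      (simp add: conjugation_conjugation)
qed (auto simp: conj_by_def conjugation_conjugation)

lemma conj_by_conj_by: "conj_by C (conj_by C T) = T"
  by (auto simp: conj_by_iff conjugation_conjugation)

lemma conj_by_mono: "S \<subseteq> T \<Longrightarrow> conj_by C S \<subseteq> conj_by C T"
  by (auto simp: conj_by_iff)

lemma linear_graph_conj_by: "linear_graph T \<Longrightarrow> linear_graph (conj_by C T)"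
  using conjugation_scaleC[of 0 0]
  by (simp add: linear_graph_def conj_by_iff conjugation_add conjugation_scaleC)

lemma conj_by_plus: "conj_by C (S + T) = conj_by C S + conj_by C T"
proof -
  have *: "conj_by C U + conj_by C V \<subseteq> conj_by C (U + V)" for U V
  proof clarify
    fix f g
    assume "(f, g) \<in> conj_by C U + conj_by C V"
    then show "(f, g) \<in> conj_by C (U + V)"
      using set_plus_intro by (fastforce elim!: set_plus_elim simp: conj_by_iff conjugation_add)
  qed
  have "conj_by C (S + T) \<subseteq> conj_by C (conj_by C (conj_by C S + conj_by C T))"
    using *[of "conj_by C S" "conj_by C T"] by (intro conj_by_mono) (simp add: conj_by_conj_by)
  then show ?thesis
    using *[of S T] by (simp only: conj_by_conj_by set_eq_subset)
qed

lemma conj_by_op_adjoint: "conj_by C (op_adjoint T) = op_adjoint (conj_by C T)"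
proof -
  have *: "op_adjoint (conj_by C T) \<subseteq> conj_by C (op_adjoint T)" for T
  proof (clarsimp simp: conj_by_iff op_adjoint_iff)
    fix g g' f f'
    assume "\<forall>f f'. (C f, C f') \<in> T \<longrightarrow> cinner f' g = cinner f g'" "(f, f') \<in> T"
    then have "cinner (C f') g = cinner (C f) g'"
      by (simp add: conjugation_conjugation)
    then show "cinner f' (C g) = cinner f (C g')"
      using cinner_conjugation[of g "C f'"] cinner_conjugation[of g' "C f"] cinner_commute
      by (metis conjugation_conjugation)
  qed
  have "conj_by C (op_adjoint T) \<subseteq> op_adjoint (conj_by C T)"
    using conj_by_mono[OF *[of "conj_by C T"]] by (simp add: conj_by_conj_by)
  with * show ?thesis
    by blast
qed

lemma conj_by_subset_op_adjoint:
  assumes "T \<subseteq> op_adjoint T"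
  shows "conj_by C T \<subseteq> op_adjoint (conj_by C T)"
  using conj_by_mono[OF assms] by (simp add: conj_by_op_adjoint)

lemma C_self_adjoint_if_self_adjoint:
  assumes "self_adjoint B" "conj_by C B = B"
  shows "C_self_adjoint C B"
  using assms by (auto simp: self_adjoint_def C_self_adjoint_def)

text \<open>
  The relation \<open>B\<close> is only assumed maximal among \<^emph>\<open>real\<close> symmetric relations. That is enough, for
  the real part \<open>(g + C g, g' + C g')\<close> and the imaginary part \<open>(\<i> (g - C g), \<i> (g' - C g'))\<close> of an
  element of \<open>B\<^sup>*\<close> are both fixed by \<open>C\<close>, and extending \<open>B\<close> by such a pair keeps it real.
\<close>

lemma self_adjoint_if_maximal_real_symmetric:
  assumes lin: "linear_graph B" and dense: "densely_defined B"
    and sym: "B \<subseteq> op_adjoint B" and real: "conj_by C B = B"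
    and maximal: "\<And>T. linear_graph T \<Longrightarrow> T \<subseteq> op_adjoint T \<Longrightarrow> conj_by C T = T \<Longrightarrow> B \<subseteq> T \<Longrightarrow> T = B"
  shows "self_adjoint B"
proof -
  have fixed: "(h, h') \<in> B" if h: "(h, h') \<in> op_adjoint B" "C h = h" "C h' = h'" for h h'
  proof -
    define L where "L = range (\<lambda>a. (a *\<^sub>C h, a *\<^sub>C h'))"
    have L: "linear_graph L"
      unfolding L_def by (rule linear_graph_range_scaleC)
    \<comment> \<open>The form is real at a pair fixed by \<open>C\<close>.\<close>
    have "cinner h' h = cinner h h'"
      using cinner_conjugation[of h h'] h by simp
    then have "L \<subseteq> op_adjoint L"
      by (auto simp: L_def op_adjoint_iff cinner_simps)
    moreover have "L \<subseteq> op_adjoint B"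
      using linear_graph_scale[OF linear_graph_op_adjoint h(1)] by (auto simp: L_def)
    moreover have "conj_by C L = L"
    proof -
      have "conj_by C L \<subseteq> L"
      proof clarify
        fix f f'
        assume "(f, f') \<in> conj_by C L"
        then obtain a where "C f = a *\<^sub>C h" "C f' = a *\<^sub>C h'"
          by (auto simp: conj_by_iff L_def)
        then have "f = cnj a *\<^sub>C h" "f' = cnj a *\<^sub>C h'"
          using h conjugation_scaleC conjugation_conjugation by metis+
        then show "(f, f') \<in> L"
          by (auto simp: L_def)
      qed
      then show ?thesis
        using conj_by_mono[of "conj_by C L" L] by (auto simp: conj_by_conj_by)
    qed
    ultimately have "B + L = B"
      using lin L sym real
      by (intro maximal linear_graph_plus plus_subset_op_adjoint subset_plus)
        (simp_all add: conj_by_plus)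
    moreover have "(h, h') \<in> L"
      unfolding L_def by (rule range_eqI[of _ _ 1]) simp
    ultimately show ?thesis
      using subset_plus(2)[OF lin L] by blast
  qed
  have "op_adjoint B \<subseteq> B"
  proof clarify
    fix g g'
    assume g: "(g, g') \<in> op_adjoint B"
    then have Cg: "(C g, C g') \<in> op_adjoint B"
      using conj_by_op_adjoint[of B] real by (metis conj_by_iff)
    note adj = linear_graph_op_adjoint[of B]
    have "(g + C g, g' + C g') \<in> B"
      using linear_graph_add[OF adj g Cg]
      by (rule fixed) (simp_all add: conjugation_add conjugation_conjugation add.commute)
    moreover have "(\<i> *\<^sub>C (g - C g), \<i> *\<^sub>C (g' - C g')) \<in> B"
      using linear_graph_scale[OF adj linear_graph_diff[OF adj g Cg]]
      by (rule fixed) (simp_all add: conjugation_scaleC conjugation_diff conjugation_conjugation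
          scaleC_minus_left scaleC_diff_right)
    ultimately have "((1/2) *\<^sub>C (g + C g) + (- \<i>/2) *\<^sub>C \<i> *\<^sub>C (g - C g),
        (1/2) *\<^sub>C (g' + C g') + (- \<i>/2) *\<^sub>C \<i> *\<^sub>C (g' - C g')) \<in> B"
      using linear_graph_add linear_graph_scale lin by blast
    moreover have "(1/2) *\<^sub>C (x + C x) + (- \<i>/2) *\<^sub>C \<i> *\<^sub>C (x - C x) = x" for x
      by (simp add: scaleC_scaleC scaleC_add_right scaleC_diff_right scaleC_add_left[symmetric])
    ultimately show "(g, g') \<in> B"
      by simp
  qed
  with sym have "B = op_adjoint B"
    by blast
  then show ?thesis
    using dense linear_op_if_subset_op_adjoint[OF lin dense sym] by (simp add: self_adjoint_def)
qed

lemma ex_real_self_adjoint_ext: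
  assumes "linear_graph S" "densely_defined S" "S \<subseteq> op_adjoint S" "conj_by C S = S"
  obtains B where "S \<subseteq> B" "self_adjoint B" "conj_by C B = B"
proof -
  define F where "F = {T. linear_graph T \<and> T \<subseteq> op_adjoint T \<and> conj_by C T = T \<and> S \<subseteq> T}"
  have "F \<noteq> {}"
    using assms by (auto simp: F_def)
  moreover have "\<Union>K \<in> F" if K: "K \<noteq> {}" "subset.chain F K" for K
  proof -
    have KF: "linear_graph T" "T \<subseteq> op_adjoint T" "conj_by C T = T" "S \<subseteq> T" if "T \<in> K" for T
      using that K(2) unfolding F_def subset_chain_def by blast+
    have common: "\<exists>T\<in>K. p \<in> T \<and> q \<in> T" if "p \<in> \<Union>K" "q \<in> \<Union>K" for p q
      using that K(2) unfolding subset_chain_def by blast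
    have "linear_graph (\<Union>K)"
      unfolding linear_graph_def
    proof (intro conjI allI impI)
      show "(0, 0) \<in> \<Union>K"
        using K(1) KF(1) linear_graph_zero by blast
    next
      fix f f' g g'
      assume "(f, f') \<in> \<Union>K" "(g, g') \<in> \<Union>K"
      then show "(f + g, f' + g') \<in> \<Union>K"
        using common KF(1) linear_graph_add by (meson UnionI)
    next
      fix a f f'
      assume "(f, f') \<in> \<Union>K"
      then show "(a *\<^sub>C f, a *\<^sub>C f') \<in> \<Union>K"
        using KF(1) linear_graph_scale by blast
    qed
    moreover have "\<Union>K \<subseteq> op_adjoint (\<Union>K)"
    proof (rule subrelI)
      fix g g'
      assume g: "(g, g') \<in> \<Union>K"
      have "cinner f' g = cinner f g'" if "(f, f') \<in> \<Union>K" for f f'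
        using common[OF g that] KF(2) op_adjointD by (meson subsetD)
      then show "(g, g') \<in> op_adjoint (\<Union>K)"
        by (simp add: op_adjoint_iff)
    qed
    moreover have "(f, f') \<in> conj_by C (\<Union>K) \<longleftrightarrow> (f, f') \<in> \<Union>K" for f f'
      unfolding conj_by_iff Union_iff using KF(3) conj_by_iff by blast
    then have "conj_by C (\<Union>K) = \<Union>K"
      by auto
    moreover have "S \<subseteq> \<Union>K"
      using K(1) KF(4) by blast
    ultimately show ?thesis
      by (simp add: F_def)
  qed
  ultimately obtain B where "B \<in> F" and B_max: "\<And>T. T \<in> F \<Longrightarrow> B \<subseteq> T \<Longrightarrow> T = B"
    using subset_Zorn_nonempty[of F] by metis
  then have B: "linear_graph B" "B \<subseteq> op_adjoint B" "conj_by C B = B" "S \<subseteq> B"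
    by (auto simp: F_def)
  have "self_adjoint B"
  proof (rule self_adjoint_if_maximal_real_symmetric)
    show "densely_defined B"
      using assms(2) B(4) by (rule densely_defined_mono)
    show "T = B" if "linear_graph T" "T \<subseteq> op_adjoint T" "conj_by C T = T" "B \<subseteq> T" for T
      using that B(4) by (intro B_max) (auto simp: F_def)
  qed (fact B)+
  with B show thesis
    using that by blast
qed

lemma conjugation_image_deficiency_space:
  "C ` deficiency_space T \<mu> = {g. (g, cnj \<mu> *\<^sub>C g) \<in> op_adjoint (conj_by C T)}"
proof -
  have "g \<in> C ` deficiency_space T \<mu> \<longleftrightarrow> C g \<in> deficiency_space T \<mu>" for g
    using conjugation_conjugation by (metis image_iff)
  then show ?thesis
    by (auto simp: deficiency_space_iff conj_by_op_adjoint[symmetric] conj_by_iff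
        conjugation_scaleC)
qed

end

section \<open>Extensions of a symmetric and complex symmetric operator\<close>

theorem theorem5p6:
  fixes C :: "'a::chilbert_space \<Rightarrow> 'a" and A :: "'a graph"
  assumes "conjugation C"
    and "symmetric_op A" and "closed A" and "\<not> maximal_symmetric A"
    and "C_symmetric C A"
  shows "(\<exists>B. A \<subseteq> B \<and> self_adjoint B \<and> C_self_adjoint C B) \<and>
    ((\<exists>\<mu>. Im \<mu> \<noteq> 0 \<and> deficiency_space A (cnj \<mu>) \<inter> C ` deficiency_space A \<mu> = {0}) \<longrightarrow>
      (\<forall>\<mu>. Im \<mu> \<noteq> 0 \<longrightarrow> deficiency_space A (cnj \<mu>) \<inter> C ` deficiency_space A \<mu> = {0}) \<and>
      (\<exists>!T. max_dissipative_ext A (conj_by C A) T) \<and>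
      (\<forall>T. max_dissipative_ext A (conj_by C A) T \<longrightarrow> self_adjoint T \<and> C_self_adjoint C T))"
proof -
  note C = assms(1)
  define S where "S = A + conj_by C A"
  have A: "linear_graph A" "densely_defined A" "A \<subseteq> op_adjoint A"
    using assms(2) by (auto simp: symmetric_op_iff linear_op_iff)
  note CA = linear_graph_conj_by[OF C A(1)]
  have AS: "A \<subseteq> S" "conj_by C A \<subseteq> S"
    using subset_plus[OF A(1) CA] by (auto simp: S_def)
  \<comment> \<open>This is the adjoint pair property of \<open>A\<close> and \<open>C A C\<close>.\<close>
  have pair: "conj_by C A \<subseteq> op_adjoint A"
    using assms(5) conj_by_mono[OF C, of A] conj_by_conj_by[OF C]
    by (auto simp: C_symmetric_def)
  have "linear_graph S" "S \<subseteq> op_adjoint S"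
    unfolding S_def using A CA pair conj_by_subset_op_adjoint[OF C A(3)]
    by (simp_all only: linear_graph_plus plus_subset_op_adjoint)
  moreover have "densely_defined S"
    using A(2) AS(1) by (rule densely_defined_mono)
  moreover have "conj_by C S = S"
    by (simp add: S_def conj_by_plus[OF C] conj_by_conj_by[OF C] add.commute)
  ultimately obtain B where B: "S \<subseteq> B" "self_adjoint B" "conj_by C B = B"
    using ex_real_self_adjoint_ext[OF C] by blast
  then have CB: "C_self_adjoint C B"
    by (intro C_self_adjoint_if_self_adjoint[OF C])
  have B_adj: "op_adjoint B = B"
    using B(2) by (simp add: self_adjoint_def)
  have S_adj: "op_adjoint S = op_adjoint A \<inter> op_adjoint (conj_by C A)"
    unfolding S_def using A(1) CA by (rule op_adjoint_plus)
  then have defic: "deficiency_space A (cnj \<mu>) \<inter> C ` deficiency_space A \<mu> =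
      {g. (g, cnj \<mu> *\<^sub>C g) \<in> op_adjoint S}" for \<mu>
    by (auto simp: conjugation_image_deficiency_space[OF C] deficiency_space_iff)
  have ext: "\<exists>B. A \<subseteq> B \<and> self_adjoint B \<and> C_self_adjoint C B"
    using B(1,2) CB AS(1) by (intro exI[of _ B] conjI) auto
  have unique: "(\<forall>\<mu>. Im \<mu> \<noteq> 0 \<longrightarrow> deficiency_space A (cnj \<mu>) \<inter> C ` deficiency_space A \<mu> = {0}) \<and>
      (\<exists>!T. max_dissipative_ext A (conj_by C A) T) \<and>
      (\<forall>T. max_dissipative_ext A (conj_by C A) T \<longrightarrow> self_adjoint T \<and> C_self_adjoint C T)"
    if ex: "\<exists>\<mu>. Im \<mu> \<noteq> 0 \<and> deficiency_space A (cnj \<mu>) \<inter> C ` deficiency_space A \<mu> = {0}"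
  proof -
    obtain \<mu> where \<mu>: "Im \<mu> \<noteq> 0" "{g. (g, cnj \<mu> *\<^sub>C g) \<in> op_adjoint S} = {0}"
      using ex unfolding defic by blast
    have SB: "op_adjoint S = B"
    proof (rule self_adjoint_eq_if_subset[OF B(2)])
      show "B \<subseteq> op_adjoint S"
        using op_adjoint_antimono[OF B(1)] by (simp only: B_adj)
      show "linear_graph (op_adjoint S)"
        by (rule linear_graph_op_adjoint)
      show "Im (cnj \<mu>) \<noteq> 0"
        using \<mu>(1) by simp
      show "g = 0" if "(g, cnj \<mu> *\<^sub>C g) \<in> op_adjoint S" for g
        using \<mu>(2) that by blast
    qed
    have defic_eq: "deficiency_space A (cnj \<nu>) \<inter> C ` deficiency_space A \<nu> = {0}"
      if "Im \<nu> \<noteq> 0" for \<nu>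
    proof -
      have "g = 0" if "(g, cnj \<nu> *\<^sub>C g) \<in> B" for g
        using nonreal_eigenvector_eq_0[OF _ that] \<open>Im \<nu> \<noteq> 0\<close> by (simp add: B_adj)
      moreover have "(0, 0) \<in> B"
        unfolding SB[symmetric] by (intro linear_graph_zero linear_graph_op_adjoint)
      ultimately show ?thesis
        unfolding defic SB by auto
    qed
    have max_B: "maximal_dissipative B"
      using B(2) by (rule maximal_dissipative_if_self_adjoint)
    have eq_B: "T = B" if T: "max_dissipative_ext A (conj_by C A) T" for T
    proof -
      have T_max: "maximal_dissipative T" "A \<subseteq> T" "conj_by C A \<subseteq> op_adjoint T"
        using T by (auto simp: max_dissipative_ext_def)
      then have "T \<subseteq> op_adjoint A"
        using dissipative_ext_subset_op_adjoint[OF A(3,1)]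
        by (simp add: maximal_dissipative_def)
      moreover have "T \<subseteq> op_adjoint (conj_by C A)"
        using T_max(3) subset_op_adjoint_commute by blast
      ultimately have "T \<subseteq> B"
        using SB S_adj by blast
      then show "T = B"
        using T_max(1) max_B unfolding maximal_dissipative_def by blast
    qed
    have "max_dissipative_ext A (conj_by C A) B"
      using max_B AS B(1) B_adj unfolding max_dissipative_ext_def by blast
    then have "\<exists>!T. max_dissipative_ext A (conj_by C A) T"
      using eq_B by (rule ex1I)
    with eq_B defic_eq B(2) CB show ?thesis
      by blast
  qed
  show ?thesis
    by (rule conjI[OF ext impI[OF unique]])
qed

end
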